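(* Let $r\ge 2$ be an integer and let $E$ be a fibrewise pointed space over $B$. If $E$ is fibrewise locally equiconnected and $E_B^r$ is a normal space, then $$\mathrm{TC}_{B,r}(E)\le \mathrm{TC}_{B,r}^B(E)\le \mathrm{TC}_{B,r}(E)+1.$$
   Context: All spaces are topological spaces, all maps are continuous, $I=[0,1]$. A fibrewise space over $B$ is a space $X$ with a map $p_X\colon X\to B$; a fibrewise map $f\colon X\to Y$ satisfies $p_Y\circ f=p_X$; $f\simeq_B g$ means there is $H\colon X\times I\to Y$ with $p_Y(H(x,t))=p_X(x)$, $H(\cdot,0)=f$, $H(\cdot,1)=g$. A fibrewise pointed space is a fibrewise space $X$ with a section $s_X\colon B\to X$ of $p_X$; a fibrewise pointed map is a fibrewise map $f$ with $f\circ s_X=s_Y$; $f\simeq_B^B g$ (fibrewise pointed homotopy) means there is a fibrewise homotopy $H$ from $f$ to $g$ with $H(s_X(b),t)=s_Y(b)$ for all $b,t$. A subspace containing $s_X(B)$ is a fibrewise pointed space. For a fibrewise map $f\colon E\to X$, $\mathrm{secat}_B(f)$ is the least $k\ge 0$ (or $\infty$) such that $X$ has an open cover $\{U_0,\dots,U_k\}$ where for each $i$ there is a fibrewise map $s_i\colon U_i\to E$ with $f\circ s_i\simeq_B i_{U_i}$ (inclusion). For a fibrewise pointed map $f$, $\mathrm{secat}_B^B(f)$ is defined likewise, requiring each $U_i\supseteq s_X(B)$, each $s_i$ fibrewise pointed, and $f\circ s_i\simeq_B^B i_{U_i}$. $E_B^r$ is the $r$-fold fibred product over $B$, with section $b\mapsto(s_E(b),\dots,s_E(b))$.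 $P_B(E)=\{(b,\alpha)\in B\times E^I\mid p_E\circ\alpha \text{ is constant at } b\}$ (compact-open topology on $E^I$), projection $(b,\alpha)\mapsto b$; $P_B^B(E)$ is $P_B(E)$ with the section $b\mapsto (b,c_{s_E(b)})$ ($c_x$ the constant path at $x$). $\Pi_{r,E}(b,\gamma)=(\gamma(0),\gamma(\tfrac1{r-1}),\dots,\gamma(1))$ defines $\Pi_{r,E}\colon P_B(E)\to E_B^r$, and $\Pi_{r,E}^B\colon P_B^B(E)\to E_B^r$ is the same map viewed as a fibrewise pointed map. $\mathrm{TC}_{B,r}(E):=\mathrm{secat}_B(\Pi_{r,E})$ and $\mathrm{TC}_{B,r}^B(E):=\mathrm{secat}_B^B(\Pi_{r,E}^B)$. $E$ is fibrewise locally equiconnected if the diagonal $E\to E\times_B E$ is a closed fibrewise cofibration (a closed embedding with the homotopy extension property for fibrewise maps and fibrewise homotopies into every fibrewise space over $B$). *)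

theory Defs
  imports "HOL-Analysis.Analysis" "HOL-Library.Extended_Nat"
begin

section \<open>Fibrewise spaces, maps and homotopies\<close>

text \<open>
  Spaces are values of type \<^typ>\<open>'a topology\<close>.  A fibrewise space over \<open>B\<close> is passed around as
  a topology \<open>X\<close> with its projection \<open>p\<close>; a fibrewise pointed space has in addition a section \<open>s\<close>.
\<close>

definition fibrewise_space :: "'b topology \<Rightarrow> 'x topology \<Rightarrow> ('x \<Rightarrow> 'b) \<Rightarrow> bool" where
  "fibrewise_space B X p \<longleftrightarrow> continuous_map X B p"

definition fibrewise_pointed_space ::
    "'b topology \<Rightarrow> 'x topology \<Rightarrow> ('x \<Rightarrow> 'b) \<Rightarrow> ('b \<Rightarrow> 'x) \<Rightarrow> bool" where
  "fibrewise_pointed_space B X p s \<longleftrightarrow>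
     fibrewise_space B X p \<and> continuous_map B X s \<and> (\<forall>b\<in>topspace B. p (s b) = b)"

definition fibrewise_map ::
    "'x topology \<Rightarrow> ('x \<Rightarrow> 'b) \<Rightarrow> 'y topology \<Rightarrow> ('y \<Rightarrow> 'b) \<Rightarrow> ('x \<Rightarrow> 'y) \<Rightarrow> bool" where
  "fibrewise_map X pX Y pY f \<longleftrightarrow> continuous_map X Y f \<and> (\<forall>x\<in>topspace X. pY (f x) = pX x)"

definition fibrewise_pointed_map ::
    "'b topology \<Rightarrow> 'x topology \<Rightarrow> ('x \<Rightarrow> 'b) \<Rightarrow> ('b \<Rightarrow> 'x) \<Rightarrow>
     'y topology \<Rightarrow> ('y \<Rightarrow> 'b) \<Rightarrow> ('b \<Rightarrow> 'y) \<Rightarrow> ('x \<Rightarrow> 'y) \<Rightarrow> bool" where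
  "fibrewise_pointed_map B X pX sX Y pY sY f \<longleftrightarrow>
     fibrewise_map X pX Y pY f \<and> (\<forall>b\<in>topspace B. f (sX b) = sY b)"

text \<open>
  Homotopies are parametrised by \<open>I \<times> X\<close> instead of \<open>X \<times> I\<close>, as in the library.  The property
  given to \<^const>\<open>homotopic_with\<close> is required of every stage of the homotopy.  That
  \<^const>\<open>homotopic_with\<close> fixes the end stages at all points of the type, not only those of
  \<open>X\<close>, is no restriction, because the properties used here only depend on the values on \<open>X\<close>.
\<close>

definition fibrewise_homotopic ::
    "'x topology \<Rightarrow> ('x \<Rightarrow> 'b) \<Rightarrow> 'y topology \<Rightarrow> ('y \<Rightarrow> 'b) \<Rightarrow> ('x \<Rightarrow> 'y) \<Rightarrow> ('x \<Rightarrow> 'y) \<Rightarrow> bool" where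
  "fibrewise_homotopic X pX Y pY f g \<longleftrightarrow>
     homotopic_with (fibrewise_map X pX Y pY) X Y f g"

definition fibrewise_pointed_homotopic ::
    "'b topology \<Rightarrow> 'x topology \<Rightarrow> ('x \<Rightarrow> 'b) \<Rightarrow> ('b \<Rightarrow> 'x) \<Rightarrow>
     'y topology \<Rightarrow> ('y \<Rightarrow> 'b) \<Rightarrow> ('b \<Rightarrow> 'y) \<Rightarrow> ('x \<Rightarrow> 'y) \<Rightarrow> ('x \<Rightarrow> 'y) \<Rightarrow> bool" where
  "fibrewise_pointed_homotopic B X pX sX Y pY sY f g \<longleftrightarrow>
     homotopic_with (fibrewise_pointed_map B X pX sX Y pY sY) X Y f g"

section \<open>Fibrewise sectional category\<close>

definition secat_cover ::
    "'e topology \<Rightarrow> ('e \<Rightarrow> 'b) \<Rightarrow> 'x topology \<Rightarrow> ('x \<Rightarrow> 'b) \<Rightarrow> ('e \<Rightarrow> 'x) \<Rightarrow> nat \<Rightarrow> bool" where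
  "secat_cover E pE X pX f k \<longleftrightarrow>
     (\<exists>U. (\<forall>i\<le>k. openin X (U i)) \<and> (\<Union>i\<le>k. U i) = topspace X \<and>
          (\<forall>i\<le>k. \<exists>\<sigma>. fibrewise_map (subtopology X (U i)) pX E pE \<sigma> \<and>
                     fibrewise_homotopic (subtopology X (U i)) pX X pX (f \<circ> \<sigma>) id))"

text \<open>The infimum of the empty set in \<^typ>\<open>enat\<close> is \<open>\<infinity>\<close>; otherwise the infimum is attained.\<close>

definition secat ::
    "'e topology \<Rightarrow> ('e \<Rightarrow> 'b) \<Rightarrow> 'x topology \<Rightarrow> ('x \<Rightarrow> 'b) \<Rightarrow> ('e \<Rightarrow> 'x) \<Rightarrow> enat" where
  "secat E pE X pX f = Inf {enat k |k. secat_cover E pE X pX f k}"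

definition pointed_secat_cover ::
    "'b topology \<Rightarrow> 'e topology \<Rightarrow> ('e \<Rightarrow> 'b) \<Rightarrow> ('b \<Rightarrow> 'e) \<Rightarrow>
     'x topology \<Rightarrow> ('x \<Rightarrow> 'b) \<Rightarrow> ('b \<Rightarrow> 'x) \<Rightarrow> ('e \<Rightarrow> 'x) \<Rightarrow> nat \<Rightarrow> bool" where
  "pointed_secat_cover B E pE sE X pX sX f k \<longleftrightarrow>
     (\<exists>U. (\<forall>i\<le>k. openin X (U i) \<and> sX ` topspace B \<subseteq> U i) \<and> (\<Union>i\<le>k. U i) = topspace X \<and>
          (\<forall>i\<le>k. \<exists>\<sigma>. fibrewise_pointed_map B (subtopology X (U i)) pX sX E pE sE \<sigma> \<and>
                     fibrewise_pointed_homotopic B (subtopology X (U i)) pX sX X pX sX (f \<circ> \<sigma>) id))"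

definition pointed_secat ::
    "'b topology \<Rightarrow> 'e topology \<Rightarrow> ('e \<Rightarrow> 'b) \<Rightarrow> ('b \<Rightarrow> 'e) \<Rightarrow>
     'x topology \<Rightarrow> ('x \<Rightarrow> 'b) \<Rightarrow> ('b \<Rightarrow> 'x) \<Rightarrow> ('e \<Rightarrow> 'x) \<Rightarrow> enat" where
  "pointed_secat B E pE sE X pX sX f = Inf {enat k |k. pointed_secat_cover B E pE sE X pX sX f k}"

section \<open>Fibred powers and fibrewise path spaces\<close>

definition fibred_power :: "nat \<Rightarrow> 'a topology \<Rightarrow> ('a \<Rightarrow> 'b) \<Rightarrow> (nat \<Rightarrow> 'a) topology" where
  "fibred_power r E p =
     subtopology (product_topology (\<lambda>_. E) {..<r}) {x. \<forall>i<r. \<forall>j<r. p (x i) = p (x j)}"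

definition fibred_power_proj :: "('a \<Rightarrow> 'b) \<Rightarrow> (nat \<Rightarrow> 'a) \<Rightarrow> 'b" where
  "fibred_power_proj p x = p (x 0)"

definition fibred_power_section :: "nat \<Rightarrow> ('b \<Rightarrow> 'a) \<Rightarrow> 'b \<Rightarrow> (nat \<Rightarrow> 'a)" where
  "fibred_power_section r s b = (\<lambda>i\<in>{..<r}. s b)"

text \<open>
  Points of \<open>E\<^sup>I\<close> are represented by functions that are \<^const>\<open>undefined\<close> off \<open>[0,1]\<close>, so that
  different points are different paths.
\<close>

definition paths :: "'a topology \<Rightarrow> (real \<Rightarrow> 'a) set" where
  "paths E = {\<gamma> \<in> extensional {0..1}. continuous_map (top_of_set {0..1}) E \<gamma>}"

definition path_space :: "'a topology \<Rightarrow> (real \<Rightarrow> 'a) topology" where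
  "path_space E = topology_generated_by
     {{\<gamma> \<in> paths E. \<gamma> ` K \<subseteq> U} |K U. compact K \<and> K \<subseteq> {0..1} \<and> openin E U}"

lemma topspace_path_space: "topspace (path_space E) = paths E"
proof
  show "topspace (path_space E) \<subseteq> paths E"
    by (auto simp: path_space_def topology_generated_by_topspace)
  have "paths E = {\<gamma> \<in> paths E. \<gamma> ` {} \<subseteq> {}}" "compact ({} :: real set)" "openin E {}"
    by auto
  then show "paths E \<subseteq> topspace (path_space E)"
    unfolding path_space_def topology_generated_by_topspace by blast
qed

definition fibrewise_path_space ::
    "'b topology \<Rightarrow> 'a topology \<Rightarrow> ('a \<Rightarrow> 'b) \<Rightarrow> ('b \<times> (real \<Rightarrow> 'a)) topology" where
  "fibrewise_path_space B E p =
     subtopology (prod_topology B (path_space E)) {(b, \<alpha>). \<forall>t\<in>{0..1}. p (\<alpha> t) = b}"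

definition fibrewise_path_section :: "('b \<Rightarrow> 'a) \<Rightarrow> 'b \<Rightarrow> 'b \<times> (real \<Rightarrow> 'a)" where
  "fibrewise_path_section s b = (b, \<lambda>t\<in>{0..1}. s b)"

definition path_evaluation :: "nat \<Rightarrow> 'b \<times> (real \<Rightarrow> 'a) \<Rightarrow> (nat \<Rightarrow> 'a)" where
  "path_evaluation r = (\<lambda>(b, \<gamma>). \<lambda>i\<in>{..<r}. \<gamma> (real i / real (r - 1)))"

section \<open>Fibrewise topological complexity\<close>

definition TC :: "'b topology \<Rightarrow> nat \<Rightarrow> 'a topology \<Rightarrow> ('a \<Rightarrow> 'b) \<Rightarrow> enat" where
  "TC B r E p =
     secat (fibrewise_path_space B E p) fst
       (fibred_power r E p) (fibred_power_proj p) (path_evaluation r)"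

definition pointed_TC ::
    "'b topology \<Rightarrow> nat \<Rightarrow> 'a topology \<Rightarrow> ('a \<Rightarrow> 'b) \<Rightarrow> ('b \<Rightarrow> 'a) \<Rightarrow> enat" where
  "pointed_TC B r E p s =
     pointed_secat B (fibrewise_path_space B E p) fst (fibrewise_path_section s)
       (fibred_power r E p) (fibred_power_proj p) (fibred_power_section r s) (path_evaluation r)"

section \<open>Closed fibrewise cofibrations and fibrewise local equiconnectedness\<close>

text \<open>
  The homotopy extension property of a fibrewise map \<open>j: A \<rightarrow> X\<close> for all fibrewise spaces over \<open>B\<close>
  whose points have type \<open>'z\<close>; a definition cannot quantify over \<open>'z\<close> itself.
\<close>

definition fibrewise_HEP ::
    "'z itself \<Rightarrow> 'b topology \<Rightarrow> 'a topology \<Rightarrow> ('a \<Rightarrow> 'b) \<Rightarrow> 'x topology \<Rightarrow> ('x \<Rightarrow> 'b) \<Rightarrow> ('a \<Rightarrow> 'x) \<Rightarrow> bool"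
  where
  "fibrewise_HEP _ B A pA X pX j \<longleftrightarrow>
     (\<forall>(Z :: 'z topology) pZ f h.
        fibrewise_space B Z pZ \<and> fibrewise_map X pX Z pZ f \<and>
        fibrewise_map (prod_topology (top_of_set {0..1::real}) A) (pA \<circ> snd) Z pZ h \<and>
        (\<forall>a\<in>topspace A. h (0, a) = f (j a)) \<longrightarrow>
        (\<exists>H. fibrewise_map (prod_topology (top_of_set {0..1::real}) X) (pX \<circ> snd) Z pZ H \<and>
             (\<forall>x\<in>topspace X. H (0, x) = f x) \<and>
             (\<forall>t\<in>{0..1}. \<forall>a\<in>topspace A. H (t, j a) = h (t, a))))"

text \<open>
  The point type \<open>real \<times> 'x\<close> accommodates the mapping cylinder of \<open>j\<close>, and the property for this
  type implies the property for all types; see the lemma below.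
\<close>

definition closed_fibrewise_cofibration ::
    "'b topology \<Rightarrow> 'a topology \<Rightarrow> ('a \<Rightarrow> 'b) \<Rightarrow> 'x topology \<Rightarrow> ('x \<Rightarrow> 'b) \<Rightarrow> ('a \<Rightarrow> 'x) \<Rightarrow> bool" where
  "closed_fibrewise_cofibration B A pA X pX (j :: 'a \<Rightarrow> 'x) \<longleftrightarrow>
     fibrewise_map A pA X pX j \<and> embedding_map A X j \<and> closedin X (j ` topspace A) \<and>
     fibrewise_HEP TYPE(real \<times> 'x) B A pA X pX j"

lemma closed_fibrewise_cofibration_HEP:
  fixes j :: "'a \<Rightarrow> 'x" and B :: "'b topology"
  assumes X: "fibrewise_space B X pX"
    and cof: "closed_fibrewise_cofibration B A pA X pX j"
  shows "fibrewise_HEP TYPE('z) B A pA X pX j"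
  unfolding fibrewise_HEP_def
proof (intro allI impI, elim conjE)
  fix Z :: "'z topology" and pZ f h
  let ?I = "top_of_set {0..1::real}"
  assume Z: "fibrewise_space B Z pZ" and f: "fibrewise_map X pX Z pZ f"
    and h: "fibrewise_map (prod_topology ?I A) (pA \<circ> snd) Z pZ h"
    and hf: "\<forall>a\<in>topspace A. h (0, a) = f (j a)"
  have jmap: "continuous_map A X j" "\<And>a. a \<in> topspace A \<Longrightarrow> pX (j a) = pA a"
    and emb: "embedding_map A X j" and clo: "closedin X (j ` topspace A)"
    and hep: "fibrewise_HEP TYPE(real \<times> 'x) B A pA X pX j"
    using cof by (auto simp: closed_fibrewise_cofibration_def fibrewise_map_def)
  have jX: "\<And>a. a \<in> topspace A \<Longrightarrow> j a \<in> topspace X"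
    using jmap(1) by (auto simp: continuous_map_def)
  obtain q where q: "homeomorphic_maps A (subtopology X (j ` topspace A)) j q"
    using emb by (auto simp: embedding_map_def homeomorphic_map_maps)
  define S where "S = {0} \<times> topspace X \<union> {0..1::real} \<times> j ` topspace A"
  define M where "M = subtopology (prod_topology ?I X) S"
  have M: "fibrewise_space B M (pX \<circ> snd)"
    using X unfolding fibrewise_space_def M_def
    by (intro continuous_map_from_subtopology continuous_map_compose[OF continuous_map_snd])
  have f0: "fibrewise_map X pX M (pX \<circ> snd) (\<lambda>x. (0, x))"
    unfolding fibrewise_map_def M_def S_def
    by (auto simp: continuous_map_in_subtopology continuous_map_pairedI)
  have h0: "fibrewise_map (prod_topology ?I A) (pA \<circ> snd) M (pX \<circ> snd) (\<lambda>z. (fst z, j (snd z)))"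
    unfolding fibrewise_map_def M_def S_def
    by (auto simp: continuous_map_in_subtopology jmap(2)
        intro!: continuous_map_pairedI continuous_map_fst
          continuous_map_compose[OF continuous_map_snd jmap(1), unfolded o_def])
  obtain R where R: "fibrewise_map (prod_topology ?I X) (pX \<circ> snd) M (pX \<circ> snd) R"
    and R0: "\<forall>x\<in>topspace X. R (0, x) = (0, x)"
    and R1: "\<forall>t\<in>{0..1}. \<forall>a\<in>topspace A. R (t, j a) = (t, j a)"
    using hep[unfolded fibrewise_HEP_def, rule_format, OF conjI, OF M conjI, OF f0 conjI, OF h0]
    by auto
  define k where "k = (\<lambda>(t, x). if x \<in> j ` topspace A then h (t, q x) else f x)"
  have qj: "\<And>a. a \<in> topspace A \<Longrightarrow> q (j a) = a"
    using q by (auto simp: homeomorphic_maps_def)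
  have contq: "continuous_map (subtopology X (j ` topspace A)) A q"
    using q by (auto simp: homeomorphic_maps_def)
  have k: "continuous_map M Z k"
  proof (rule pasting_lemma_closed[where I = "{False, True}"
        and T = "\<lambda>c. if c then {0..1} \<times> j ` topspace A else {0} \<times> topspace X"
        and f = "\<lambda>c. if c then \<lambda>z. h (fst z, q (snd z)) else f \<circ> snd"])
    fix c assume "c \<in> {False, True}"
    have "closedin (prod_topology ?I X) (if c then {0..1} \<times> j ` topspace A else {0} \<times> topspace X)"
      by (cases c) (auto simp: closedin_prod_Times_iff clo intro!: closedin_subset closed_subset)
    then show "closedin M (if c then {0..1} \<times> j ` topspace A else {0} \<times> topspace X)"
      unfolding M_def by (rule closedin_subset_topspace) (auto simp: S_def)
    show "continuous_map (subtopology M (if c then {0..1} \<times> j ` topspace A else {0} \<times> topspace X)) Z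
            (if c then \<lambda>z. h (fst z, q (snd z)) else f \<circ> snd)"
    proof (cases c)
      case True
      have eq: "subtopology M ({0..1} \<times> j ` topspace A) =
            prod_topology ?I (subtopology X (j ` topspace A))"
        unfolding M_def S_def
        by (simp add: subtopology_subtopology prod_topology_subtopology Int_absorb1 Un_Int_distrib2
            flip: subtopology_Times)
           (rule arg_cong[where f = "subtopology (prod_topology euclideanreal X)"], blast)
      have "continuous_map (prod_topology ?I (subtopology X (j ` topspace A))) Z
              (h \<circ> (\<lambda>z. (fst z, q (snd z))))"
        using h unfolding fibrewise_map_def
        by (intro continuous_map_compose[where X' = "prod_topology ?I A"] continuous_map_pairedI
            continuous_map_fst continuous_map_compose[OF continuous_map_snd contq, unfolded o_def])
           auto
      then show ?thesis
        using True eq by (simp add: o_def)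
    next
      case False
      have "continuous_map (prod_topology ?I X) Z (f \<circ> snd)"
        using f unfolding fibrewise_map_def
        by (intro continuous_map_compose[OF continuous_map_snd]) auto
      then show ?thesis
        using False by (simp add: M_def continuous_map_from_subtopology)
    qed
  next
    fix c d z
    assume "z \<in> topspace M \<inter> (if c then {0..1} \<times> j ` topspace A else {0} \<times> topspace X)
              \<inter> (if d then {0..1} \<times> j ` topspace A else {0} \<times> topspace X)"
    then show "(if c then \<lambda>z. h (fst z, q (snd z)) else f \<circ> snd) z =
               (if d then \<lambda>z. h (fst z, q (snd z)) else f \<circ> snd) z"
      using hf by (cases c; cases d) (auto simp: qj)
  next
    fix z assume "z \<in> topspace M"
    then show "\<exists>c. c \<in> {False, True} \<and>
        z \<in> (if c then {0..1} \<times> j ` topspace A else {0} \<times> topspace X) \<and>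
        k z = (if c then \<lambda>z. h (fst z, q (snd z)) else f \<circ> snd) z"
      by (intro exI[of _ "snd z \<in> j ` topspace A"], cases z)
         (simp add: M_def S_def k_def mem_Times_iff, blast)
  qed simp
  have kp: "pZ (k z) = pX (snd z)" if "z \<in> topspace M" for z
    using that f h by (auto simp: M_def S_def k_def fibrewise_map_def qj jmap(2))
  have RM: "R z \<in> topspace M" if "z \<in> topspace (prod_topology ?I X)" for z
    using R that by (auto simp: fibrewise_map_def continuous_map_def)
  show "\<exists>H. fibrewise_map (prod_topology ?I X) (pX \<circ> snd) Z pZ H \<and>
             (\<forall>x\<in>topspace X. H (0, x) = f x) \<and>
             (\<forall>t\<in>{0..1}. \<forall>a\<in>topspace A. H (t, j a) = h (t, a))"
  proof (intro exI[of _ "k \<circ> R"] conjI ballI)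
    show "fibrewise_map (prod_topology ?I X) (pX \<circ> snd) Z pZ (k \<circ> R)"
      using R k kp RM unfolding fibrewise_map_def
      by (auto intro: continuous_map_compose)
  next
    fix x assume "x \<in> topspace X"
    then show "(k \<circ> R) (0, x) = f x"
      using R0 hf by (auto simp: k_def qj)
  next
    fix t :: real and a assume "t \<in> {0..1}" "a \<in> topspace A"
    then show "(k \<circ> R) (t, j a) = h (t, a)"
      using R1 by (auto simp: k_def qj)
  qed
qed

definition fibrewise_locally_equiconnected :: "'b topology \<Rightarrow> 'a topology \<Rightarrow> ('a \<Rightarrow> 'b) \<Rightarrow> bool" where
  "fibrewise_locally_equiconnected B E p \<longleftrightarrow>
     closed_fibrewise_cofibration B E p
       (subtopology (prod_topology E E) {(x, y). p x = p y}) (p \<circ> fst) (\<lambda>x. (x, x))"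

end

theory Submission
  imports Defs
begin

text \<open>
  The first inequality holds because a pointed local section becomes an unpointed one when the
  condition on the base section is forgotten (\<open>secat_le_pointed_secat\<close>).

  For the second, write \<open>X\<close> for the fibred power \<open>E\<^sub>B\<^sup>r\<close> and \<open>s\<^sub>X\<close> for its section.  Local
  equiconnectedness enters only through two consequences: the section \<open>s\<^sub>X(B)\<close> is closed in \<open>X\<close>,
  and it has an open neighbourhood \<open>N\<close> that is fibrewise pointed categorical, that is, over which
  the inclusion is pointed homotopic to \<open>s\<^sub>X \<circ> p\<^sub>X\<close>.  The map sending \<open>x\<close> to the constant path at
  \<open>s(p\<^sub>X(x))\<close> is then a pointed local section of the evaluation map over \<open>N\<close>.  To obtain \<open>N\<close>, a
  closed fibrewise cofibration is shown to have a neighbourhood that deforms into it with the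
  subspace fixed (\<open>closed_fibrewise_cofibration_deformation\<close>).  For the diagonal of \<open>E\<close> this gives,
  for points \<open>x\<close>, \<open>y\<close> of one fibre that are close together, two fibrewise paths starting at \<open>x\<close> and \<open>y\<close>
  with a common end; they join \<open>s(p(x))\<close> to \<open>x\<close> for \<open>x\<close> near \<open>s(B)\<close>
  (\<open>locally_equiconnected_categorical_nbhd\<close>).  The deformation passes to \<open>X\<close> coordinate by
  coordinate (\<open>fibred_power_categorical\<close>).

  Given an unpointed cover \<open>U\<^sub>0, \<dots>, U\<^sub>k\<close>, normality provides an open \<open>M\<close> with
  \<open>s\<^sub>X(B) \<subseteq> M \<subseteq> cl M \<subseteq> N\<close>.  Each \<open>U\<^sub>i - cl M\<close> is open and disjoint from \<open>M\<close>, so the given section on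
  it and the pointed section on \<open>M\<close> together form a pointed section on \<open>M \<union> (U\<^sub>i - cl M)\<close>.  These
  \<open>k + 1\<close> sets miss only points of \<open>cl M\<close>, and \<open>N\<close>, the one additional set, contains those
  (\<open>pointed_secat_le_secat_plus_1\<close>).
\<close>

section \<open>Explicit fibrewise homotopies\<close>

abbreviation unit_interval :: "real topology" where
  "unit_interval \<equiv> top_of_set {0..1}"

lemma continuous_map_homotopy_stage:
  assumes "continuous_map (prod_topology unit_interval X) Y h" "t \<in> {0..1}"
  shows "continuous_map X Y (\<lambda>x. h (t, x))"
  using continuous_map_compose[OF continuous_map_pairedI[of X unit_interval "\<lambda>x. t" X "\<lambda>x. x"] assms(1)]
    assms(2) by (simp add: o_def)

lemma fibrewise_map_cong:
  assumes "\<And>x. x \<in> topspace X \<Longrightarrow> f x = g x"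
  shows "fibrewise_map X pX Y pY f \<longleftrightarrow> fibrewise_map X pX Y pY g"
  using assms continuous_map_eq[of X Y f g] continuous_map_eq[of X Y g f]
  by (auto simp: fibrewise_map_def)

lemma fibrewise_homotopic_iff:
  "fibrewise_homotopic X pX Y pY f g \<longleftrightarrow>
     (\<exists>h. continuous_map (prod_topology unit_interval X) Y h \<and>
          (\<forall>x\<in>topspace X. h (0, x) = f x) \<and> (\<forall>x\<in>topspace X. h (1, x) = g x) \<and>
          (\<forall>t\<in>{0..1}. \<forall>x\<in>topspace X. pY (h (t, x)) = pX x))"
proof -
  have "fibrewise_homotopic X pX Y pY f g \<longleftrightarrow>
     (\<exists>h. continuous_map (prod_topology unit_interval X) Y h \<and>
          (\<forall>x\<in>topspace X. h (0, x) = f x) \<and> (\<forall>x\<in>topspace X. h (1, x) = g x) \<and>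
          (\<forall>t\<in>{0..1}. fibrewise_map X pX Y pY (\<lambda>x. h (t, x))))"
    unfolding fibrewise_homotopic_def
    by (rule homotopic_with) (rule fibrewise_map_cong)
  also have "\<dots> \<longleftrightarrow> (\<exists>h. continuous_map (prod_topology unit_interval X) Y h \<and>
          (\<forall>x\<in>topspace X. h (0, x) = f x) \<and> (\<forall>x\<in>topspace X. h (1, x) = g x) \<and>
          (\<forall>t\<in>{0..1}. \<forall>x\<in>topspace X. pY (h (t, x)) = pX x))"
    using continuous_map_homotopy_stage unfolding fibrewise_map_def
    by (intro arg_cong[where f = Ex] ext) blast
  finally show ?thesis .
qed

text \<open>
  The section must lie in \<open>X\<close>: a pointed map is constrained at the points \<open>sX b\<close>, and only there
  can two maps that agree on \<open>X\<close> be exchanged.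
\<close>

lemma fibrewise_pointed_homotopic_iff:
  fixes X :: "'x topology" and Y :: "'y topology"
  assumes "sX ` topspace B \<subseteq> topspace X"
  shows "fibrewise_pointed_homotopic B X pX sX Y pY sY f g \<longleftrightarrow>
     (\<exists>h. continuous_map (prod_topology unit_interval X) Y h \<and>
          (\<forall>x\<in>topspace X. h (0, x) = f x) \<and> (\<forall>x\<in>topspace X. h (1, x) = g x) \<and>
          (\<forall>t\<in>{0..1}. \<forall>x\<in>topspace X. pY (h (t, x)) = pX x) \<and>
          (\<forall>t\<in>{0..1}. \<forall>b\<in>topspace B. h (t, sX b) = sY b))"
proof -
  have "fibrewise_pointed_homotopic B X pX sX Y pY sY f g \<longleftrightarrow>
     (\<exists>h. continuous_map (prod_topology unit_interval X) Y h \<and>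
          (\<forall>x\<in>topspace X. h (0, x) = f x) \<and> (\<forall>x\<in>topspace X. h (1, x) = g x) \<and>
          (\<forall>t\<in>{0..1}. fibrewise_pointed_map B X pX sX Y pY sY (\<lambda>x. h (t, x))))"
    unfolding fibrewise_pointed_homotopic_def
  proof (rule homotopic_with)
    fix h k :: "'x \<Rightarrow> 'y" assume eq: "\<And>x. x \<in> topspace X \<Longrightarrow> h x = k x"
    then have "\<forall>b\<in>topspace B. h (sX b) = k (sX b)"
      using assms by (auto simp: image_subset_iff)
    then show "fibrewise_pointed_map B X pX sX Y pY sY h \<longleftrightarrow>
        fibrewise_pointed_map B X pX sX Y pY sY k"
      using fibrewise_map_cong[of X h k pX Y pY, OF eq] by (simp add: fibrewise_pointed_map_def)
  qed
  also have "\<dots> \<longleftrightarrow> (\<exists>h. continuous_map (prod_topology unit_interval X) Y h \<and>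
          (\<forall>x\<in>topspace X. h (0, x) = f x) \<and> (\<forall>x\<in>topspace X. h (1, x) = g x) \<and>
          (\<forall>t\<in>{0..1}. \<forall>x\<in>topspace X. pY (h (t, x)) = pX x) \<and>
          (\<forall>t\<in>{0..1}. \<forall>b\<in>topspace B. h (t, sX b) = sY b))"
    using continuous_map_homotopy_stage unfolding fibrewise_map_def fibrewise_pointed_map_def
    by (intro arg_cong[where f = Ex] ext) blast
  finally show ?thesis .
qed

section \<open>Pointed and unpointed sectional category\<close>

definition local_section ::
    "'e topology \<Rightarrow> ('e \<Rightarrow> 'b) \<Rightarrow> 'x topology \<Rightarrow> ('x \<Rightarrow> 'b) \<Rightarrow> ('e \<Rightarrow> 'x) \<Rightarrow> 'x set \<Rightarrow> bool" where
  "local_section E pE X pX f U \<longleftrightarrow>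
     (\<exists>\<sigma>. fibrewise_map (subtopology X U) pX E pE \<sigma> \<and>
          fibrewise_homotopic (subtopology X U) pX X pX (f \<circ> \<sigma>) id)"

definition pointed_local_section ::
    "'b topology \<Rightarrow> 'e topology \<Rightarrow> ('e \<Rightarrow> 'b) \<Rightarrow> ('b \<Rightarrow> 'e) \<Rightarrow>
     'x topology \<Rightarrow> ('x \<Rightarrow> 'b) \<Rightarrow> ('b \<Rightarrow> 'x) \<Rightarrow> ('e \<Rightarrow> 'x) \<Rightarrow> 'x set \<Rightarrow> bool" where
  "pointed_local_section B E pE sE X pX sX f U \<longleftrightarrow>
     (\<exists>\<sigma>. fibrewise_pointed_map B (subtopology X U) pX sX E pE sE \<sigma> \<and>
          fibrewise_pointed_homotopic B (subtopology X U) pX sX X pX sX (f \<circ> \<sigma>) id)"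

lemma secat_le_pointed_secat:
  "secat E pE X pX f \<le> pointed_secat B E pE sE X pX sX f"
proof -
  have "local_section E pE X pX f U" if sec: "pointed_local_section B E pE sE X pX sX f U" for U
  proof -
    obtain \<sigma> where "fibrewise_pointed_map B (subtopology X U) pX sX E pE sE \<sigma>"
      and hom: "fibrewise_pointed_homotopic B (subtopology X U) pX sX X pX sX (f \<circ> \<sigma>) id"
      using sec unfolding pointed_local_section_def by blast
    then have "fibrewise_map (subtopology X U) pX E pE \<sigma>"
      by (simp add: fibrewise_pointed_map_def)
    moreover have "fibrewise_homotopic (subtopology X U) pX X pX (f \<circ> \<sigma>) id"
      using hom unfolding fibrewise_homotopic_def fibrewise_pointed_homotopic_def
      by (rule homotopic_with_mono) (simp add: fibrewise_pointed_map_def)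
    ultimately show ?thesis
      unfolding local_section_def by blast
  qed
  then have "secat_cover E pE X pX f k" if "pointed_secat_cover B E pE sE X pX sX f k" for k
    using that unfolding secat_cover_def pointed_secat_cover_def
      local_section_def[symmetric] pointed_local_section_def[symmetric]
    by (elim ex_forward) simp
  then show ?thesis
    unfolding secat_def pointed_secat_def by (intro Inf_superset_mono) blast
qed

lemma continuous_map_disjoint_open_Un:
  assumes "openin X A" "openin X C" "A \<inter> C = {}" "topspace X = A \<union> C"
    and f: "continuous_map (subtopology X A) Y f" and g: "continuous_map (subtopology X C) Y g"
  shows "continuous_map X Y (\<lambda>x. if x \<in> A then f x else g x)"
proof (rule pasting_lemma[where I = "{True, False}" and T = "\<lambda>c. if c then A else C"
      and f = "\<lambda>c. if c then f else g"])
  fix x assume "x \<in> topspace X"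
  then show "\<exists>c. c \<in> {True, False} \<and> x \<in> (if c then A else C) \<and>
      (if x \<in> A then f x else g x) = (if c then f else g) x"
    using assms(3,4) by (intro exI[of _ "x \<in> A"]) auto
qed (use assms in \<open>auto split: if_splits\<close>)

text \<open>
  The base section lies entirely in \<open>A\<close>, so the section over \<open>C\<close> and its homotopy carry no pointedness
  condition; and as \<open>A\<close> and \<open>C\<close> are disjoint and open, nothing has to match when maps are combined.
\<close>

lemma pointed_local_section_disjoint_Un:
  assumes A: "openin X A" and C: "openin X C" and disj: "A \<inter> C = {}"
    and sA: "sX ` topspace B \<subseteq> A"
    and secA: "pointed_local_section B E pE sE X pX sX f A"
    and secC: "local_section E pE X pX f C"
  shows "pointed_local_section B E pE sE X pX sX f (A \<union> C)"
proof -
  have AX: "A \<subseteq> topspace X" and CX: "C \<subseteq> topspace X"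
    using A C by (auto dest: openin_subset)
  then have ts: "topspace (subtopology X A) = A" "topspace (subtopology X C) = C"
      "topspace (subtopology X (A \<union> C)) = A \<union> C"
    by auto
  have pt: "sX ` topspace B \<subseteq> topspace (subtopology X A)"
    using sA ts(1) by simp
  obtain \<sigma> h where \<sigma>: "continuous_map (subtopology X A) E \<sigma>" "\<And>x. x \<in> A \<Longrightarrow> pE (\<sigma> x) = pX x"
      "\<And>b. b \<in> topspace B \<Longrightarrow> \<sigma> (sX b) = sE b"
    and h: "continuous_map (prod_topology unit_interval (subtopology X A)) X h"
      "\<And>x. x \<in> A \<Longrightarrow> h (0, x) = f (\<sigma> x)" "\<And>x. x \<in> A \<Longrightarrow> h (1, x) = x"
      "\<And>t x. t \<in> {0..1} \<Longrightarrow> x \<in> A \<Longrightarrow> pX (h (t, x)) = pX x"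
      "\<And>t b. t \<in> {0..1} \<Longrightarrow> b \<in> topspace B \<Longrightarrow> h (t, sX b) = sX b"
    using secA
    unfolding pointed_local_section_def fibrewise_pointed_map_def fibrewise_map_def
      fibrewise_pointed_homotopic_iff[OF pt] ts o_apply id_apply
    by (elim exE conjE) blast
  obtain \<tau> k where \<tau>: "continuous_map (subtopology X C) E \<tau>" "\<And>x. x \<in> C \<Longrightarrow> pE (\<tau> x) = pX x"
    and k: "continuous_map (prod_topology unit_interval (subtopology X C)) X k"
      "\<And>x. x \<in> C \<Longrightarrow> k (0, x) = f (\<tau> x)" "\<And>x. x \<in> C \<Longrightarrow> k (1, x) = x"
      "\<And>t x. t \<in> {0..1} \<Longrightarrow> x \<in> C \<Longrightarrow> pX (k (t, x)) = pX x"
    using secC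
    unfolding local_section_def fibrewise_map_def fibrewise_homotopic_iff ts o_apply id_apply
    by (elim exE conjE) blast
  let ?\<rho> = "\<lambda>x. if x \<in> A then \<sigma> x else \<tau> x"
  let ?I = unit_interval
  let ?l = "\<lambda>z. if z \<in> {0..1} \<times> A then h z else k z"
  have sub_open: "openin (subtopology X (A \<union> C)) A" "openin (subtopology X (A \<union> C)) C"
    using A C by (auto simp: openin_open_subtopology[OF openin_Un[OF A C]])
  have rho: "continuous_map (subtopology X (A \<union> C)) E ?\<rho>"
    by (rule continuous_map_disjoint_open_Un[where C = C])
       (use sub_open disj ts \<sigma>(1) \<tau>(1) in \<open>auto simp: subtopology_subtopology Int_absorb1\<close>)
  have sub: "subtopology (prod_topology ?I (subtopology X (A \<union> C))) ({0..1} \<times> D) =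
      prod_topology ?I (subtopology X D)" if "D \<subseteq> A \<union> C" for D
    using that by (simp add: subtopology_Times subtopology_subtopology Int_absorb1)
  have l: "continuous_map (prod_topology ?I (subtopology X (A \<union> C))) X ?l"
  proof (rule continuous_map_disjoint_open_Un[where C = "{0..1} \<times> C"])
    show "openin (prod_topology ?I (subtopology X (A \<union> C))) ({0..1} \<times> A)"
      "openin (prod_topology ?I (subtopology X (A \<union> C))) ({0..1} \<times> C)"
      using sub_open by (auto simp: openin_prod_Times_iff)
  qed (use disj ts h(1) k(1) in \<open>auto simp: sub\<close>)
  have "fibrewise_pointed_map B (subtopology X (A \<union> C)) pX sX E pE sE ?\<rho>"
    unfolding fibrewise_pointed_map_def fibrewise_map_def
    using rho \<sigma> \<tau> sA ts by auto
  moreover have "fibrewise_pointed_homotopic B (subtopology X (A \<union> C)) pX sX X pX sX (f \<circ> ?\<rho>) id"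
  proof (subst fibrewise_pointed_homotopic_iff)
    show "sX ` topspace B \<subseteq> topspace (subtopology X (A \<union> C))"
      using sA ts by auto
    have "\<forall>x\<in>A \<union> C. ?l (0, x) = (f \<circ> ?\<rho>) x" "\<forall>x\<in>A \<union> C. ?l (1, x) = id x"
      "\<forall>t\<in>{0..1}. \<forall>x\<in>A \<union> C. pX (?l (t, x)) = pX x"
      "\<forall>t\<in>{0..1}. \<forall>b\<in>topspace B. ?l (t, sX b) = sX b"
      using h k sA by auto
    then show "\<exists>h. continuous_map (prod_topology ?I (subtopology X (A \<union> C))) X h \<and>
          (\<forall>x\<in>topspace (subtopology X (A \<union> C)). h (0, x) = (f \<circ> ?\<rho>) x) \<and>
          (\<forall>x\<in>topspace (subtopology X (A \<union> C)). h (1, x) = id x) \<and>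
          (\<forall>t\<in>{0..1}. \<forall>x\<in>topspace (subtopology X (A \<union> C)). pX (h (t, x)) = pX x) \<and>
          (\<forall>t\<in>{0..1}. \<forall>b\<in>topspace B. h (t, sX b) = sX b)"
      unfolding ts(3) using l by blast
  qed
  ultimately show ?thesis
    unfolding pointed_local_section_def by blast
qed

lemma local_section_subset:
  assumes "V \<subseteq> U" and sec: "local_section E pE X pX f U"
  shows "local_section E pE X pX f V"
proof -
  have sub: "subtopology X V = subtopology (subtopology X U) V"
    using assms(1) by (simp add: subtopology_subtopology Int_absorb1)
  have res: "continuous_map (prod_topology unit_interval (subtopology X V)) X h"
    if "continuous_map (prod_topology unit_interval (subtopology X U)) X h" for h
    unfolding sub prod_topology_subtopology(2)[of _ "subtopology X U"]
    using that by (rule continuous_map_from_subtopology)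
  show ?thesis
    using sec assms(1) unfolding local_section_def fibrewise_homotopic_iff fibrewise_map_def
    by (elim ex_forward conj_forward) (auto intro: continuous_map_from_subtopology_mono res)
qed

lemma pointed_local_section_subset:
  assumes "V \<subseteq> U" "V \<subseteq> topspace X" "sX ` topspace B \<subseteq> V"
    and sec: "pointed_local_section B E pE sE X pX sX f U"
  shows "pointed_local_section B E pE sE X pX sX f V"
proof -
  have sub: "subtopology X V = subtopology (subtopology X U) V"
    using assms(1) by (simp add: subtopology_subtopology Int_absorb1)
  have res: "continuous_map (prod_topology unit_interval (subtopology X V)) X h"
    if "continuous_map (prod_topology unit_interval (subtopology X U)) X h" for h
    unfolding sub prod_topology_subtopology(2)[of _ "subtopology X U"]
    using that by (rule continuous_map_from_subtopology)
  have pt: "sX ` topspace B \<subseteq> topspace (subtopology X V)" "sX ` topspace B \<subseteq> topspace (subtopology X U)"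
    using assms by auto
  show ?thesis
    using sec assms(1) unfolding pointed_local_section_def fibrewise_pointed_map_def fibrewise_map_def
      fibrewise_pointed_homotopic_iff[OF pt(1)] fibrewise_pointed_homotopic_iff[OF pt(2)]
    by (elim ex_forward conj_forward) (auto intro: continuous_map_from_subtopology_mono res)
qed

text \<open>
  Away from a closed neighbourhood of the base section, pointedness is no condition, so every
  unpointed section can be cut off there and replaced near the base section by the section over \<open>N\<close>.
  What the cutting loses is covered by \<open>N\<close> itself.
\<close>

lemma pointed_secat_le_secat_plus_1:
  assumes X: "normal_space X" and clo: "closedin X (sX ` topspace B)"
    and N: "openin X N" "sX ` topspace B \<subseteq> N"
    and sec: "pointed_local_section B E pE sE X pX sX f N"
  shows "pointed_secat B E pE sE X pX sX f \<le> secat E pE X pX f + 1"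
proof (cases "\<exists>k. secat_cover E pE X pX f k")
  case False
  \<comment> \<open>The unpointed sectional category is then infinite.\<close>
  then show ?thesis by (simp add: secat_def Inf_enat_def)
next
  case True
  then have "secat E pE X pX f \<in> {enat k |k. secat_cover E pE X pX f k}"
    unfolding secat_def Inf_enat_def by (auto intro: LeastI)
  then obtain k where k: "secat E pE X pX f = enat k" and "secat_cover E pE X pX f k"
    by blast
  then obtain U where U: "\<And>i. i \<le> k \<Longrightarrow> openin X (U i)" "(\<Union>i\<le>k. U i) = topspace X"
      "\<And>i. i \<le> k \<Longrightarrow> local_section E pE X pX f (U i)"
    unfolding secat_cover_def local_section_def[symmetric] by blast
  obtain M where M: "openin X M" "sX ` topspace B \<subseteq> M" "X closure_of M \<subseteq> N"
    using X[unfolded normal_space_alt, rule_format, OF conjI, OF clo conjI, OF N] by blast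
  have MM: "M \<subseteq> X closure_of M"
    using M(1) by (simp add: closure_of_subset openin_subset)
  define W where "W i = (if i \<le> k then M \<union> (U i - X closure_of M) else N)" for i
  have "openin X (W i) \<and> sX ` topspace B \<subseteq> W i" for i
    using M N U(1) by (auto simp: W_def intro!: openin_Un openin_diff)
  moreover have "(\<Union>i\<le>Suc k. W i) = topspace X"
  proof
    show "(\<Union>i\<le>Suc k. W i) \<subseteq> topspace X"
      using calculation by (auto dest: openin_subset)
    show "topspace X \<subseteq> (\<Union>i\<le>Suc k. W i)"
    proof
      fix x assume "x \<in> topspace X"
      then obtain i where i: "i \<le> k" "x \<in> U i" using U(2) by blast
      show "x \<in> (\<Union>i\<le>Suc k. W i)"
      proof (cases "x \<in> X closure_of M")
        case True
        then have "x \<in> W (Suc k)" using M(3) by (auto simp: W_def)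
        then show ?thesis by blast
      next
        case False
        then have "x \<in> W i" using i by (simp add: W_def)
        then show ?thesis using i(1) by (intro UN_I[of i]) auto
      qed
    qed
  qed
  moreover have "pointed_local_section B E pE sE X pX sX f (W i)" for i
  proof (cases "i \<le> k")
    case True
    have "pointed_local_section B E pE sE X pX sX f (M \<union> (U i - X closure_of M))"
    proof (rule pointed_local_section_disjoint_Un)
      show "pointed_local_section B E pE sE X pX sX f M"
        using MM M openin_subset[OF M(1)] by (intro pointed_local_section_subset[OF _ _ _ sec]) auto
      show "local_section E pE X pX f (U i - X closure_of M)"
        using U(3)[OF True] by (rule local_section_subset[rotated]) auto
    qed (use M MM U(1) True in auto)
    then show ?thesis using True by (simp add: W_def)
  qed (simp add: W_def sec)
  ultimately have "pointed_secat_cover B E pE sE X pX sX f (Suc k)"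
    unfolding pointed_secat_cover_def pointed_local_section_def[symmetric]
    by (intro exI[of _ W]) simp
  then have "pointed_secat B E pE sE X pX sX f \<le> enat (Suc k)"
    unfolding pointed_secat_def by (intro Inf_lower) blast
  then show ?thesis by (simp add: k one_enat_def)
qed

section \<open>Neighbourhoods of closed fibrewise cofibrations\<close>

text \<open>
  The homotopy extension property applied to the mapping cylinder
  \<open>{0} \<times> X \<union> [0,1] \<times> j(A)\<close> yields a retraction \<open>R\<close> of \<open>[0,1] \<times> X\<close> onto it.  Its second component is
  the deformation.  A point of the cylinder at positive height lies over \<open>j(A)\<close>; hence the points
  that \<open>R\<close> moves at time \<open>1\<close> to positive height form the required neighbourhood, which is open
  because the height of \<open>R (1, x)\<close> is continuous in \<open>x\<close>.
\<close>

lemma closed_fibrewise_cofibration_deformation: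
  fixes j :: "'a \<Rightarrow> 'x" and B :: "'b topology"
  assumes X: "fibrewise_space B X pX"
    and cof: "closed_fibrewise_cofibration B A pA X pX j"
  obtains V H where "openin X V" "j ` topspace A \<subseteq> V"
    and "fibrewise_map (prod_topology unit_interval X) (pX \<circ> snd) X pX H"
    and "\<And>x. x \<in> topspace X \<Longrightarrow> H (0, x) = x"
    and "\<And>t a. t \<in> {0..1} \<Longrightarrow> a \<in> topspace A \<Longrightarrow> H (t, j a) = j a"
    and "\<And>x. x \<in> V \<Longrightarrow> H (1, x) \<in> j ` topspace A"
proof -
  let ?I = unit_interval
  have jmap: "continuous_map A X j" "\<And>a. a \<in> topspace A \<Longrightarrow> pX (j a) = pA a"
    and hep: "fibrewise_HEP TYPE(real \<times> 'x) B A pA X pX j"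
    using cof by (auto simp: closed_fibrewise_cofibration_def fibrewise_map_def)
  have jX: "\<And>a. a \<in> topspace A \<Longrightarrow> j a \<in> topspace X"
    using jmap(1) by (auto simp: continuous_map_def)
  define S where "S = {0} \<times> topspace X \<union> {0..1::real} \<times> j ` topspace A"
  define M where "M = subtopology (prod_topology ?I X) S"
  have M: "fibrewise_space B M (pX \<circ> snd)"
    using X unfolding fibrewise_space_def M_def
    by (intro continuous_map_from_subtopology continuous_map_compose[OF continuous_map_snd])
  have f0: "fibrewise_map X pX M (pX \<circ> snd) (\<lambda>x. (0, x))"
    unfolding fibrewise_map_def M_def S_def
    by (auto simp: continuous_map_in_subtopology continuous_map_pairedI)
  have h0: "fibrewise_map (prod_topology ?I A) (pA \<circ> snd) M (pX \<circ> snd) (\<lambda>z. (fst z, j (snd z)))"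
    unfolding fibrewise_map_def M_def S_def
    by (auto simp: continuous_map_in_subtopology jmap(2)
        intro!: continuous_map_pairedI continuous_map_fst
          continuous_map_compose[OF continuous_map_snd jmap(1), unfolded o_def])
  \<comment> \<open>\<open>R\<close> extends the two inclusions into the cylinder, so it is the identity on the cylinder.\<close>
  obtain R where R: "fibrewise_map (prod_topology ?I X) (pX \<circ> snd) M (pX \<circ> snd) R"
    and R0: "\<forall>x\<in>topspace X. R (0, x) = (0, x)"
    and R1: "\<forall>t\<in>{0..1}. \<forall>a\<in>topspace A. R (t, j a) = (t, j a)"
    using hep[unfolded fibrewise_HEP_def, rule_format, OF conjI, OF M conjI, OF f0 conjI, OF h0]
    by auto
  have Rc: "continuous_map (prod_topology ?I X) (prod_topology ?I X) R"
    and RM: "\<And>z. z \<in> topspace (prod_topology ?I X) \<Longrightarrow> R z \<in> S"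
    and Rp: "\<And>t x. t \<in> {0..1} \<Longrightarrow> x \<in> topspace X \<Longrightarrow> pX (snd (R (t, x))) = pX x"
    using R by (auto simp: fibrewise_map_def M_def continuous_map_in_subtopology image_subset_iff Pi_iff)
  have Rfst: "continuous_map X euclideanreal (\<lambda>x. fst (R (1, x)))"
  proof -
    have "continuous_map X (prod_topology ?I X) (\<lambda>x. R (1, x))"
      using continuous_map_compose[OF continuous_map_pairedI[of X ?I "\<lambda>x. 1" X "\<lambda>x. x"] Rc]
      by (simp add: o_def)
    then show ?thesis
      using continuous_map_compose[OF _ continuous_map_fst, of X ?I X "\<lambda>x. R (1, x)"]
      by (simp add: o_def continuous_map_in_subtopology)
  qed
  define V where "V = {x \<in> topspace X. fst (R (1, x)) \<in> {0<..}}"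
  show thesis
  proof (rule that[of V "snd \<circ> R"])
    show "openin X V"
      unfolding V_def by (rule openin_continuous_map_preimage[OF Rfst]) auto
    show "j ` topspace A \<subseteq> V"
      using R1 jX by (auto simp: V_def)
    show "fibrewise_map (prod_topology ?I X) (pX \<circ> snd) X pX (snd \<circ> R)"
      unfolding fibrewise_map_def using Rp
      by (auto intro: continuous_map_compose[OF Rc continuous_map_snd])
    fix x assume "x \<in> V"
    then show "(snd \<circ> R) (1, x) \<in> j ` topspace A"
      using RM[of "(1, x)"] by (auto simp: V_def S_def)
  qed (use R0 R1 in auto)
qed

section \<open>Categorical neighbourhoods of the base section\<close>

definition fibrewise_pointed_categorical ::
    "'b topology \<Rightarrow> 'x topology \<Rightarrow> ('x \<Rightarrow> 'b) \<Rightarrow> ('b \<Rightarrow> 'x) \<Rightarrow> 'x set \<Rightarrow> bool" where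
  "fibrewise_pointed_categorical B X p s N \<longleftrightarrow>
     openin X N \<and> s ` topspace B \<subseteq> N \<and>
     fibrewise_pointed_homotopic B (subtopology X N) p s X p s (s \<circ> p) id"

text \<open>
  Near the diagonal, \<open>(x, y)\<close> deforms within its fibre to some \<open>(z, z)\<close>, which provides paths from \<open>x\<close>
  to \<open>z\<close> and from \<open>y\<close> to \<open>z\<close>.  Pulled back along \<open>x \<mapsto> (s(p x), x)\<close>, which sends the base section into
  the diagonal, the two components are homotopies from \<open>s \<circ> p\<close> and from the inclusion to the same
  map \<open>c\<close>.  They are pointed because the deformation fixes the diagonal.
\<close>

lemma locally_equiconnected_categorical_nbhd:
  assumes E: "fibrewise_pointed_space B E p s" and lec: "fibrewise_locally_equiconnected B E p"
  obtains N where "fibrewise_pointed_categorical B E p s N"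
proof -
  define D where "D = subtopology (prod_topology E E) {(x, y). p x = p y}"
  have p: "continuous_map E B p" and s: "continuous_map B E s"
    and ps: "\<And>b. b \<in> topspace B \<Longrightarrow> p (s b) = b"
    using E by (auto simp: fibrewise_pointed_space_def fibrewise_space_def)
  have pB: "\<And>x. x \<in> topspace E \<Longrightarrow> p x \<in> topspace B" and sE: "\<And>b. b \<in> topspace B \<Longrightarrow> s b \<in> topspace E"
    using p s by (auto simp: continuous_map_def)
  have sp: "continuous_map E E (\<lambda>x. s (p x))"
    using continuous_map_compose[OF p s] by (simp add: o_def)
  have D: "fibrewise_space B D (p \<circ> fst)"
    unfolding fibrewise_space_def D_def
    by (intro continuous_map_from_subtopology continuous_map_compose[OF continuous_map_fst p])
  have cof: "closed_fibrewise_cofibration B E p D (p \<circ> fst) (\<lambda>x. (x, x))"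
    using lec by (simp add: fibrewise_locally_equiconnected_def D_def)
  obtain V H where V: "openin D V" "(\<lambda>x. (x, x)) ` topspace E \<subseteq> V"
    and H: "fibrewise_map (prod_topology unit_interval D) (p \<circ> fst \<circ> snd) D (p \<circ> fst) H"
    and H0: "\<And>x. x \<in> topspace D \<Longrightarrow> H (0, x) = x"
    and Hd: "\<And>t a. t \<in> {0..1} \<Longrightarrow> a \<in> topspace E \<Longrightarrow> H (t, (a, a)) = (a, a)"
    and H1: "\<And>x. x \<in> V \<Longrightarrow> H (1, x) \<in> (\<lambda>x. (x, x)) ` topspace E"
    by (rule closed_fibrewise_cofibration_deformation[OF D cof]) (rule that)
  define g where "g = (\<lambda>x. (s (p x), x))"
  have g: "continuous_map E D g"
    unfolding g_def D_def using sp
    by (auto simp: continuous_map_in_subtopology ps pB intro!: continuous_map_pairedI)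
  have gD: "\<And>x. x \<in> topspace E \<Longrightarrow> g x \<in> topspace D"
    using g by (auto simp: continuous_map_def)
  define N where "N = {x \<in> topspace E. g x \<in> V}"
  have N: "openin E N"
    unfolding N_def using g V(1) by (rule openin_continuous_map_preimage)
  have gs: "g (s b) = (s b, s b)" if "b \<in> topspace B" for b
    using that by (simp add: g_def ps)
  have sN: "s ` topspace B \<subseteq> N"
    using V(2) sE by (auto simp: N_def gs)
  let ?EN = "subtopology E N"
  have tsN: "topspace ?EN = N" by (auto simp: N_def)
  define c where "c = (\<lambda>x. fst (H (1, g x)))"
  have Hg: "continuous_map (prod_topology unit_interval ?EN) D (\<lambda>z. H (fst z, g (snd z)))"
  proof -
    have "continuous_map (prod_topology unit_interval ?EN) D (g \<circ> snd)"
      by (rule continuous_map_compose[OF continuous_map_snd continuous_map_from_subtopology[OF g]])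
    then have "continuous_map (prod_topology unit_interval ?EN) (prod_topology unit_interval D)
        (\<lambda>z. (fst z, g (snd z)))"
      by (intro continuous_map_pairedI continuous_map_fst) (simp add: o_def)
    then show ?thesis
      using H continuous_map_compose[of _ _ _ D H] by (fastforce simp: fibrewise_map_def o_def)
  qed
  then have Hfst: "continuous_map (prod_topology unit_interval ?EN) E (\<lambda>z. fst (H (fst z, g (snd z))))"
    and Hsnd: "continuous_map (prod_topology unit_interval ?EN) E (\<lambda>z. snd (H (fst z, g (snd z))))"
    unfolding D_def continuous_map_in_subtopology continuous_map_pairwise by (auto simp: o_def)
  have Hp: "p (fst (H (t, g x))) = p x" "p (snd (H (t, g x))) = p x"
    if "t \<in> {0..1}" "x \<in> topspace E" for t x
  proof -
    have z: "(t, g x) \<in> topspace (prod_topology unit_interval D)" using that gD by simp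
    then have "p (fst (H (t, g x))) = p (fst (g x))" "H (t, g x) \<in> topspace D"
      using H by (auto simp: fibrewise_map_def continuous_map_def)
    then show "p (fst (H (t, g x))) = p x" "p (snd (H (t, g x))) = p x"
      using that by (auto simp: g_def ps pB D_def split: prod.splits)
  qed
  have Hg0: "fst (H (0, g x)) = s (p x)" "snd (H (0, g x)) = x" if "x \<in> topspace E" for x
    using H0[OF gD[OF that]] by (simp_all add: g_def)
  have c: "snd (H (1, g x)) = c x" if "x \<in> N" for x
    using H1[of "g x"] that by (auto simp: c_def N_def)
  have pt: "s ` topspace B \<subseteq> topspace ?EN" using sN tsN by simp
  have "fibrewise_pointed_homotopic B ?EN p s E p s (s \<circ> p) c"
    unfolding fibrewise_pointed_homotopic_iff[OF pt] tsN
    by (rule exI[of _ "\<lambda>z. fst (H (fst z, g (snd z)))"])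
       (use Hfst Hp Hg0 sE in \<open>auto simp: c_def gs Hd N_def\<close>)
  moreover have "fibrewise_pointed_homotopic B ?EN p s E p s id c"
    unfolding fibrewise_pointed_homotopic_iff[OF pt] tsN
    by (rule exI[of _ "\<lambda>z. snd (H (fst z, g (snd z)))"])
       (use Hsnd Hp Hg0 sE c in \<open>auto simp: gs Hd N_def\<close>)
  ultimately have "fibrewise_pointed_homotopic B ?EN p s E p s (s \<circ> p) id"
    unfolding fibrewise_pointed_homotopic_def
    by (metis homotopic_with_sym homotopic_with_trans)
  with N sN show thesis
    by (intro that) (simp add: fibrewise_pointed_categorical_def)
qed

text \<open>
  A point \<open>x\<close> lies on the section exactly if \<open>(s(p x), x)\<close> lies on the diagonal, which is closed in
  \<open>E \<times>\<^sub>B E\<close>.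
\<close>

lemma locally_equiconnected_closedin_section:
  assumes E: "fibrewise_pointed_space B E p s" and lec: "fibrewise_locally_equiconnected B E p"
  shows "closedin E (s ` topspace B)"
proof -
  let ?D = "subtopology (prod_topology E E) {(x, y). p x = p y}"
  have p: "continuous_map E B p" and s: "continuous_map B E s"
    and ps: "\<And>b. b \<in> topspace B \<Longrightarrow> p (s b) = b"
    using E by (auto simp: fibrewise_pointed_space_def fibrewise_space_def)
  have pB: "\<And>x. x \<in> topspace E \<Longrightarrow> p x \<in> topspace B" and sE: "\<And>b. b \<in> topspace B \<Longrightarrow> s b \<in> topspace E"
    using p s by (auto simp: continuous_map_def)
  have "continuous_map E ?D (\<lambda>x. (s (p x), x))"
    using continuous_map_compose[OF p s]
    by (auto simp: continuous_map_in_subtopology ps pB o_def intro!: continuous_map_pairedI)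
  moreover have "closedin ?D ((\<lambda>x. (x, x)) ` topspace E)"
    using lec by (simp add: fibrewise_locally_equiconnected_def closed_fibrewise_cofibration_def)
  ultimately have "closedin E {x \<in> topspace E. (s (p x), x) \<in> (\<lambda>x. (x, x)) ` topspace E}"
    by (rule closedin_continuous_map_preimage)
  also have "{x \<in> topspace E. (s (p x), x) \<in> (\<lambda>x. (x, x)) ` topspace E} = s ` topspace B"
  proof
    show "{x \<in> topspace E. (s (p x), x) \<in> (\<lambda>x. (x, x)) ` topspace E} \<subseteq> s ` topspace B"
      using pB by force
  qed (use sE ps in auto)
  finally show ?thesis .
qed

section \<open>Passage to fibred powers\<close>

lemma topspace_fibred_power:
  "x \<in> topspace (fibred_power r E p) \<longleftrightarrow>
     x \<in> extensional {..<r} \<and> (\<forall>i<r. x i \<in> topspace E) \<and> (\<forall>i<r. \<forall>j<r. p (x i) = p (x j))"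
  by (auto simp: fibred_power_def PiE_iff)

lemma fibred_power_same_fibre:
  "x \<in> topspace (fibred_power r E p) \<Longrightarrow> i < r \<Longrightarrow> j < r \<Longrightarrow> p (x i) = p (x j)"
  unfolding topspace_fibred_power by blast

lemma fibred_power_extensional:
  "x \<in> topspace (fibred_power r E p) \<Longrightarrow> x \<in> extensional {..<r}"
  unfolding topspace_fibred_power by blast

lemma continuous_map_fibred_power_component:
  "i < r \<Longrightarrow> continuous_map (fibred_power r E p) E (\<lambda>x. x i)"
  unfolding fibred_power_def
  by (rule continuous_map_from_subtopology) (rule continuous_map_product_projection, simp)

text \<open>
  A point of the fibred power all of whose coordinates lie in \<open>s(B)\<close> has equal coordinates, because
  \<open>s(B)\<close> meets every fibre only once.
\<close>

lemma fibred_power_closedin_section: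
  assumes E: "fibrewise_pointed_space B E p s" and clo: "closedin E (s ` topspace B)" and r: "r > 0"
  shows "closedin (fibred_power r E p) (fibred_power_section r s ` topspace B)"
proof -
  let ?X = "fibred_power r E p"
  have s: "continuous_map B E s" and ps: "\<And>b. b \<in> topspace B \<Longrightarrow> p (s b) = b"
    using E by (auto simp: fibrewise_pointed_space_def)
  have sE: "\<And>b. b \<in> topspace B \<Longrightarrow> s b \<in> topspace E"
    using s by (auto simp: continuous_map_def)
  have "closedin ?X (\<Inter>i<r. {x \<in> topspace ?X. x i \<in> s ` topspace B})"
    using r clo
    by (intro closedin_Inter)
       (auto intro!: closedin_continuous_map_preimage[OF continuous_map_fibred_power_component])
  also have "(\<Inter>i<r. {x \<in> topspace ?X. x i \<in> s ` topspace B}) = fibred_power_section r s ` topspace B"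
  proof (intro equalityI subsetI)
    fix x assume x: "x \<in> (\<Inter>i<r. {x \<in> topspace ?X. x i \<in> s ` topspace B})"
    then have xX: "x \<in> topspace ?X" and xs: "\<And>i. i < r \<Longrightarrow> x i \<in> s ` topspace B"
      using r by auto
    obtain b where b: "b \<in> topspace B" "x 0 = s b" using xs[OF r] by blast
    have "x i = s b" if i: "i < r" for i
    proof -
      obtain b' where b': "b' \<in> topspace B" "x i = s b'" using xs[OF i] by blast
      have "p (x i) = p (x 0)" using fibred_power_same_fibre[OF xX i r] .
      then show ?thesis using b b' ps by simp
    qed
    then have "x = fibred_power_section r s b"
      using fibred_power_extensional[OF xX]
      by (auto simp: fibred_power_section_def intro!: extensionalityI[where A = "{..<r}"])
    then show "x \<in> fibred_power_section r s ` topspace B" using b by blast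
  next
    fix x assume "x \<in> fibred_power_section r s ` topspace B"
    then show "x \<in> (\<Inter>i<r. {x \<in> topspace ?X. x i \<in> s ` topspace B})"
      using sE by (auto simp: topspace_fibred_power fibred_power_section_def)
  qed
  finally show ?thesis .
qed

text \<open>
  The homotopy is applied in every coordinate.  As it is fibrewise, the coordinates stay in a common
  fibre.
\<close>

lemma fibred_power_categorical:
  assumes E: "fibrewise_pointed_space B E p s" and r: "r > 0"
    and cat: "fibrewise_pointed_categorical B E p s N"
  shows "fibrewise_pointed_categorical B (fibred_power r E p) (fibred_power_proj p)
           (fibred_power_section r s) {x \<in> topspace (fibred_power r E p). \<forall>i<r. x i \<in> N}"
    (is "fibrewise_pointed_categorical B ?X ?p ?s ?N")
proof -
  have s: "continuous_map B E s" and ps: "\<And>b. b \<in> topspace B \<Longrightarrow> p (s b) = b"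
    using E by (auto simp: fibrewise_pointed_space_def)
  have sE: "\<And>b. b \<in> topspace B \<Longrightarrow> s b \<in> topspace E"
    using s by (auto simp: continuous_map_def)
  have N: "openin E N" and sN: "s ` topspace B \<subseteq> N"
    and hom: "fibrewise_pointed_homotopic B (subtopology E N) p s E p s (s \<circ> p) id"
    using cat by (auto simp: fibrewise_pointed_categorical_def)
  have NE: "N \<subseteq> topspace E" using N by (rule openin_subset)
  then have tsN: "topspace (subtopology E N) = N" by auto
  have pt: "s ` topspace B \<subseteq> topspace (subtopology E N)" using sN tsN by simp
  obtain h where h: "continuous_map (prod_topology unit_interval (subtopology E N)) E h"
    and h0: "\<And>x. x \<in> N \<Longrightarrow> h (0, x) = s (p x)" and h1: "\<And>x. x \<in> N \<Longrightarrow> h (1, x) = x"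
    and hp: "\<And>t x. t \<in> {0..1} \<Longrightarrow> x \<in> N \<Longrightarrow> p (h (t, x)) = p x"
    and hs: "\<And>t b. t \<in> {0..1} \<Longrightarrow> b \<in> topspace B \<Longrightarrow> h (t, s b) = s b"
    using hom unfolding fibrewise_pointed_homotopic_iff[OF pt] tsN by auto
  have "?N = (\<Inter>i<r. {x \<in> topspace ?X. x i \<in> N})" using r by auto
  moreover have "openin ?X (\<Inter>i<r. {x \<in> topspace ?X. x i \<in> N})"
    using r N
    by (intro openin_Inter)
       (auto intro!: openin_continuous_map_preimage[OF continuous_map_fibred_power_component])
  ultimately have open_N: "openin ?X ?N" by simp
  have sub: "?s ` topspace B \<subseteq> ?N"
    using sN sE by (auto simp: topspace_fibred_power fibred_power_section_def)
  let ?XN = "subtopology ?X ?N"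
  have tsXN: "topspace ?XN = ?N" by auto
  define k where "k = (\<lambda>(t, x). \<lambda>i\<in>{..<r}. h (t, x i))"
  have kc: "continuous_map (prod_topology unit_interval ?XN) E (\<lambda>z. h (fst z, snd z i))"
    if i: "i < r" for i
  proof -
    have "continuous_map ?XN (subtopology E N) (\<lambda>x. x i)"
      using i continuous_map_from_subtopology[OF continuous_map_fibred_power_component[OF i]]
      by (auto simp: continuous_map_in_subtopology)
    then have "continuous_map (prod_topology unit_interval ?XN) (subtopology E N) ((\<lambda>x. x i) \<circ> snd)"
      by (rule continuous_map_compose[OF continuous_map_snd])
    then have "continuous_map (prod_topology unit_interval ?XN)
        (prod_topology unit_interval (subtopology E N)) (\<lambda>z. (fst z, snd z i))"
      by (intro continuous_map_pairedI continuous_map_fst) (simp add: o_def)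
    from continuous_map_compose[OF this h] show ?thesis by (simp add: o_def)
  qed
  have k: "continuous_map (prod_topology unit_interval ?XN) ?X k"
  proof -
    have "p (k z i) = p (k z j)"
      if z: "z \<in> topspace (prod_topology unit_interval ?XN)" and ij: "i < r" "j < r" for z i j
    proof -
      have "p (k z i) = p (snd z i)" "p (k z j) = p (snd z j)"
        using z ij by (auto simp: k_def hp)
      moreover have "p (snd z i) = p (snd z j)"
        using z ij by (intro fibred_power_same_fibre[where E = E]) auto
      ultimately show ?thesis by simp
    qed
    moreover have "continuous_map (prod_topology unit_interval ?XN) (product_topology (\<lambda>_. E) {..<r}) k"
      unfolding continuous_map_componentwise using kc by (auto simp: k_def case_prod_beta)
    ultimately have "continuous_map (prod_topology unit_interval ?XN)
        (subtopology (product_topology (\<lambda>_. E) {..<r}) {x. \<forall>i<r. \<forall>j<r. p (x i) = p (x j)}) k"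
      unfolding continuous_map_in_subtopology by blast
    then show ?thesis
      by (simp only: fibred_power_def)
  qed
  have "fibrewise_pointed_homotopic B ?XN ?p ?s ?X ?p ?s (?s \<circ> ?p) id"
  proof (subst fibrewise_pointed_homotopic_iff)
    show "?s ` topspace B \<subseteq> topspace ?XN"
      using sub tsXN by simp
    have "k (0, x) = (?s \<circ> ?p) x" "k (1, x) = id x" if x: "x \<in> ?N" for x
    proof -
      have "h (0, x i) = s (p (x 0))" if i: "i < r" for i
      proof -
        have "h (0, x i) = s (p (x i))"
          using x i by (intro h0) auto
        also have "p (x i) = p (x 0)"
          using x r i by (intro fibred_power_same_fibre[where E = E]) auto
        finally show ?thesis .
      qed
      then show "k (0, x) = (?s \<circ> ?p) x"
        by (simp add: k_def fibred_power_section_def fibred_power_proj_def cong: restrict_cong)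
      show "k (1, x) = id x"
        using x fibred_power_extensional[of x r E p]
        by (auto simp: k_def h1 intro!: extensionalityI[where A = "{..<r}"])
    qed
    moreover have "\<forall>t\<in>{0..1}. \<forall>x\<in>?N. ?p (k (t, x)) = ?p x"
      using r by (auto simp: k_def fibred_power_proj_def hp)
    moreover have "\<forall>t\<in>{0..1}. \<forall>b\<in>topspace B. k (t, ?s b) = ?s b"
      by (auto simp: k_def fibred_power_section_def hs intro!: restrict_ext)
    ultimately show "\<exists>h. continuous_map (prod_topology unit_interval ?XN) ?X h \<and>
          (\<forall>x\<in>topspace ?XN. h (0, x) = (?s \<circ> ?p) x) \<and> (\<forall>x\<in>topspace ?XN. h (1, x) = id x) \<and>
          (\<forall>t\<in>{0..1}. \<forall>x\<in>topspace ?XN. ?p (h (t, x)) = ?p x) \<and>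
          (\<forall>t\<in>{0..1}. \<forall>b\<in>topspace B. h (t, ?s b) = ?s b)"
      unfolding tsXN using k by blast
  qed
  with open_N sub show ?thesis
    unfolding fibrewise_pointed_categorical_def by blast
qed

section \<open>Sections of the evaluation map\<close>

lemma continuous_map_fibrewise_path_section:
  assumes E: "fibrewise_pointed_space B E p s"
  shows "continuous_map B (fibrewise_path_space B E p) (fibrewise_path_section s)"
proof -
  have s: "continuous_map B E s" and ps: "\<And>b. b \<in> topspace B \<Longrightarrow> p (s b) = b"
    using E by (auto simp: fibrewise_pointed_space_def)
  let ?c = "\<lambda>b. \<lambda>t\<in>{0..1::real}. s b"
  have c: "?c b \<in> paths E" if "b \<in> topspace B" for b
  proof -
    have "continuous_map unit_interval E (?c b)"
      by (rule continuous_map_eq[where f = "\<lambda>t. s b"]) (use s that in \<open>auto simp: continuous_map_def\<close>)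
    then show ?thesis
      by (simp add: paths_def)
  qed
  have "continuous_map B (path_space E) ?c"
    unfolding path_space_def
  proof (rule continuous_on_generated_topo)
    fix W assume "W \<in> {{\<gamma> \<in> paths E. \<gamma> ` K \<subseteq> U} |K U. compact K \<and> K \<subseteq> {0..1} \<and> openin E U}"
    then obtain K U where W: "W = {\<gamma> \<in> paths E. \<gamma> ` K \<subseteq> U}" and K: "K \<subseteq> {0..1}" and U: "openin E U"
      by blast
    \<comment> \<open>For \<open>K = {}\<close> the condition on \<open>s b\<close> is vacuous, which makes this a separate case.\<close>
    have mem: "?c b \<in> W \<longleftrightarrow> K = {} \<or> s b \<in> U" if "b \<in> topspace B" for b
    proof -
      have "?c b ` K = (\<lambda>t. s b) ` K"
        using K by (intro image_cong) auto
      also have "\<dots> \<subseteq> U \<longleftrightarrow> K = {} \<or> s b \<in> U"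
        by auto
      finally show ?thesis
        using c[OF that] by (simp only: W mem_Collect_eq simp_thms)
    qed
    have "?c -` W \<inter> topspace B = {b \<in> topspace B. ?c b \<in> W}"
      by blast
    also have "\<dots> = (if K = {} then topspace B else {b \<in> topspace B. s b \<in> U})"
      by (simp add: mem cong: conj_cong)
    finally have "?c -` W \<inter> topspace B = \<dots>" .
    then show "openin B (?c -` W \<inter> topspace B)"
      using openin_continuous_map_preimage[OF s U] by simp
  next
    show "?c ` topspace B \<subseteq> \<Union> {{\<gamma> \<in> paths E. \<gamma> ` K \<subseteq> U} |K U. compact K \<and> K \<subseteq> {0..1} \<and> openin E U}"
      using c topspace_path_space[of E] unfolding path_space_def topology_generated_by_topspace by blast
  qed
  then show ?thesis
    unfolding fibrewise_path_space_def fibrewise_path_section_def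
    by (auto simp: continuous_map_in_subtopology ps intro!: continuous_map_pairedI)
qed

lemma path_evaluation_fibrewise_path_section:
  "path_evaluation r (fibrewise_path_section s b) = fibred_power_section r s b"
  by (auto simp: path_evaluation_def fibrewise_path_section_def fibred_power_section_def divide_le_eq_1
      intro!: restrict_ext)

text \<open>
  Over a categorical set, \<open>sE \<circ> pX\<close> is a pointed section of any \<open>f\<close> that respects the base sections:
  its composite with \<open>f\<close> is \<open>sX \<circ> pX\<close>.
\<close>

lemma pointed_local_section_categorical:
  assumes X: "fibrewise_pointed_space B X pX sX"
    and sE: "continuous_map B E sE" "\<And>b. b \<in> topspace B \<Longrightarrow> pE (sE b) = b"
    and f: "\<And>b. b \<in> topspace B \<Longrightarrow> f (sE b) = sX b"
    and cat: "fibrewise_pointed_categorical B X pX sX N"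
  shows "pointed_local_section B E pE sE X pX sX f N"
proof -
  have pX: "continuous_map X B pX" and ps: "\<And>b. b \<in> topspace B \<Longrightarrow> pX (sX b) = b"
    using X by (auto simp: fibrewise_pointed_space_def fibrewise_space_def)
  have pB: "\<And>x. x \<in> topspace X \<Longrightarrow> pX x \<in> topspace B"
    using pX by (auto simp: continuous_map_def)
  have N: "openin X N" and sN: "sX ` topspace B \<subseteq> N"
    and hom: "fibrewise_pointed_homotopic B (subtopology X N) pX sX X pX sX (sX \<circ> pX) id"
    using cat by (auto simp: fibrewise_pointed_categorical_def)
  have pt: "sX ` topspace B \<subseteq> topspace (subtopology X N)"
    using sN openin_subset[OF N] by auto
  have "fibrewise_pointed_map B (subtopology X N) pX sX E pE sE (sE \<circ> pX)"
    unfolding fibrewise_pointed_map_def fibrewise_map_def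
    using continuous_map_compose[OF continuous_map_from_subtopology[OF pX] sE(1)] sE(2) pB ps by auto
  moreover have "fibrewise_pointed_homotopic B (subtopology X N) pX sX X pX sX (f \<circ> (sE \<circ> pX)) id"
    using hom f pB unfolding fibrewise_pointed_homotopic_iff[OF pt] by simp
  ultimately show ?thesis
    unfolding pointed_local_section_def by blast
qed

lemma fibrewise_pointed_space_fibred_power:
  assumes E: "fibrewise_pointed_space B E p s" and r: "r > 0"
  shows "fibrewise_pointed_space B (fibred_power r E p) (fibred_power_proj p) (fibred_power_section r s)"
proof -
  have p: "continuous_map E B p" and s: "continuous_map B E s"
    and ps: "\<And>b. b \<in> topspace B \<Longrightarrow> p (s b) = b"
    using E by (auto simp: fibrewise_pointed_space_def fibrewise_space_def)
  have "continuous_map (fibred_power r E p) B (fibred_power_proj p)"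
    using continuous_map_compose[OF continuous_map_fibred_power_component[OF r] p]
    by (simp add: fibred_power_proj_def[abs_def] o_def)
  moreover have "continuous_map B (fibred_power r E p) (fibred_power_section r s)"
    unfolding fibred_power_def continuous_map_in_subtopology continuous_map_componentwise
    using s by (auto simp: fibred_power_section_def)
  ultimately show ?thesis
    using r ps by (simp add: fibrewise_pointed_space_def fibrewise_space_def
        fibred_power_proj_def fibred_power_section_def)
qed

theorem corollary3p12:
  fixes B :: "'b topology" and E :: "'a topology"
    and p :: "'a \<Rightarrow> 'b" and s :: "'b \<Rightarrow> 'a" and r :: nat
  assumes "r \<ge> 2"
    and "fibrewise_pointed_space B E p s"
    and "fibrewise_locally_equiconnected B E p"
    and "normal_space (fibred_power r E p)"
  shows "TC B r E p \<le> pointed_TC B r E p s \<and> pointed_TC B r E p s \<le> TC B r E p + 1"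
proof
  have r: "r > 0" using assms(1) by simp
  show "TC B r E p \<le> pointed_TC B r E p s"
    unfolding TC_def pointed_TC_def by (rule secat_le_pointed_secat)
  obtain N where "fibrewise_pointed_categorical B E p s N"
    using locally_equiconnected_categorical_nbhd[OF assms(2,3)] .
  from fibred_power_categorical[OF assms(2) r this]
  obtain N' where cat: "fibrewise_pointed_categorical B (fibred_power r E p) (fibred_power_proj p)
      (fibred_power_section r s) N'" by blast
  show "pointed_TC B r E p s \<le> TC B r E p + 1"
    unfolding TC_def pointed_TC_def
  proof (rule pointed_secat_le_secat_plus_1[OF assms(4)])
    show "closedin (fibred_power r E p) (fibred_power_section r s ` topspace B)"
      by (rule fibred_power_closedin_section[OF assms(2)
            locally_equiconnected_closedin_section[OF assms(2,3)] r])
    show "pointed_local_section B (fibrewise_path_space B E p) fst (fibrewise_path_section s)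
        (fibred_power r E p) (fibred_power_proj p) (fibred_power_section r s) (path_evaluation r) N'"
      by (rule pointed_local_section_categorical[OF
            fibrewise_pointed_space_fibred_power[OF assms(2) r]
            continuous_map_fibrewise_path_section[OF assms(2)] _ _ cat])
         (auto simp: path_evaluation_fibrewise_path_section, simp add: fibrewise_path_section_def)
  qed (use cat in \<open>auto simp: fibrewise_pointed_categorical_def\<close>)
qed

end
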